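(* Let $X:[0,\infty]\to s\mathbf{Set}$ be a diagram (functor) of simplicial sets. Then the inclusion $\mathrm{sk}_1X\subset X$ induces an isomorphism of ep-metric spaces $$\Re(\mathrm{sk}_1X)\xrightarrow{\ \cong\ }\Re(X).$$
   Context: An ep-metric space (extended pseudo-metric space) is a set $Y$ with a function $d:Y\times Y\to[0,\infty]$ such that $d(x,x)=0$, $d(x,y)=d(y,x)$ and $d(x,z)\le d(x,y)+d(y,z)$. A morphism $f:(X,d_X)\to(Y,d_Y)$ is a function with $d_Y(f(x),f(y))\le d_X(x,y)$ for all $x,y$. The resulting category $ep\text{-}\mathbf{Met}$ is cocomplete. The interval $[0,\infty]$ is regarded as a poset category; for a functor $X:[0,\infty]\to s\mathbf{Set}$ write $X_s$ for its value at $s$. The diagram $\mathrm{sk}_1X$ is given by $(\mathrm{sk}_1X)_s=\mathrm{sk}_1(X_s)$, the $1$-skeleton of the simplicial set $X_s$. For a simplicial set $K$ and $s\in[0,\infty]$, $L_sK:[0,\infty]\to s\mathbf{Set}$ is the diagram with $(L_sK)_t=\emptyset$ for $t<s$ and $(L_sK)_t=K$ for $t\ge s$ (with identity transition maps); maps $L_sK\to X$ correspond to simplicial set maps $K\to X_s$. The category of simplices $\mathbf{\Delta}/X$ has objects the maps $L_s\Delta^n\to X$ ($s\in[0,\infty]$, $n\ge0$) and morphisms the maps $L_t\Delta^m\to L_s\Delta^n$ over $X$; such a map consists of a relation $s\le t$ and a simplicial map $\theta:\Delta^m\to\Delta^n$. $U^n_s$ is the ep-metric space with underlying set $\mathbf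 n=\{0,1,\dots,n\}$ and $d(i,j)=s$ for $i\neq j$. A morphism $L_t\Delta^m\to L_s\Delta^n$, consisting of a relation $s\le t$ and a simplicial map $\theta:\Delta^m\to\Delta^n$, induces the morphism $\theta:U^m_t\to U^n_s$ given by the vertex function $\theta:\mathbf m\to\mathbf n$. The realization of $X$ is the colimit in $ep\text{-}\mathbf{Met}$ $$\Re(X)=\varinjlim_{L_s\Delta^n\to X}U^n_s$$ indexed by $\mathbf{\Delta}/X$; it is functorial in $X$. *)

theory Defs
  imports "HOL-Library.Extended_Nonnegative_Real" "HOL-Library.FuncSet"
begin

(* Throughout, morphisms are extensional functions on carriers (elements of PiE), so that equality
   of morphisms is equality of HOL functions. The poset [0,infinity] is the type ennreal. *)

section \<open>Extended pseudo-metric spaces\<close>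

record 'a epms =
  pts :: "'a set"
  dst :: "'a \<Rightarrow> 'a \<Rightarrow> ennreal"

definition ep_metric :: "'a epms \<Rightarrow> bool" where
  "ep_metric Y \<longleftrightarrow>
     (\<forall>x\<in>pts Y. dst Y x x = 0) \<and>
     (\<forall>x\<in>pts Y. \<forall>y\<in>pts Y. dst Y x y = dst Y y x) \<and>
     (\<forall>x\<in>pts Y. \<forall>y\<in>pts Y. \<forall>z\<in>pts Y. dst Y x z \<le> dst Y x y + dst Y y z)"

definition ep_map :: "'a epms \<Rightarrow> 'b epms \<Rightarrow> ('a \<Rightarrow> 'b) \<Rightarrow> bool" where
  "ep_map X Y f \<longleftrightarrow> f \<in> pts X \<rightarrow>\<^sub>E pts Y \<and>
     (\<forall>x\<in>pts X. \<forall>y\<in>pts X. dst Y (f x) (f y) \<le> dst X x y)"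

definition ep_iso :: "'a epms \<Rightarrow> 'b epms \<Rightarrow> ('a \<Rightarrow> 'b) \<Rightarrow> bool" where
  "ep_iso X Y f \<longleftrightarrow> ep_metric X \<and> ep_metric Y \<and> ep_map X Y f \<and>
     (\<exists>g. ep_map Y X g \<and> (\<forall>x\<in>pts X. g (f x) = x) \<and> (\<forall>y\<in>pts Y. f (g y) = y))"


section \<open>Colimits of ep-metric spaces\<close>

(* A diagram of ep-metric spaces. Cocones and colimits depend only on the underlying graph of the
   index category, so its composition is not recorded. *)
record ('j, 'm, 'b) ep_diagram =
  idx :: "'j set"
  arr :: "'j \<Rightarrow> 'j \<Rightarrow> 'm set"
  spc :: "'j \<Rightarrow> 'b epms"
  mor :: "'j \<Rightarrow> 'j \<Rightarrow> 'm \<Rightarrow> 'b \<Rightarrow> 'b"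

definition is_ep_diagram :: "('j, 'm, 'b) ep_diagram \<Rightarrow> bool" where
  "is_ep_diagram D \<longleftrightarrow>
     (\<forall>j\<in>idx D. ep_metric (spc D j)) \<and>
     (\<forall>i\<in>idx D. \<forall>j\<in>idx D. \<forall>h\<in>arr D i j. ep_map (spc D i) (spc D j) (mor D i j h))"

definition ep_cocone ::
  "('j, 'm, 'b) ep_diagram \<Rightarrow> 'c epms \<Rightarrow> ('j \<Rightarrow> 'b \<Rightarrow> 'c) \<Rightarrow> bool" where
  "ep_cocone D Z c \<longleftrightarrow>
     (\<forall>j\<in>idx D. ep_map (spc D j) Z (c j)) \<and>
     (\<forall>i\<in>idx D. \<forall>j\<in>idx D. \<forall>h\<in>arr D i j. \<forall>x\<in>pts (spc D i). c j (mor D i j h x) = c i x)"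

(* The colimit: its set of points is the colimit of the underlying sets, a quotient of the
   disjoint union, and its distance is the largest ep-metric for which all the canonical maps are
   ep-metric morphisms. The universal property is lemma ep_colim_universal below. *)
definition colim_sum :: "('j, 'm, 'b) ep_diagram \<Rightarrow> ('j \<times> 'b) set" where
  "colim_sum D = (SIGMA j:idx D. pts (spc D j))"

definition colim_gen :: "('j, 'm, 'b) ep_diagram \<Rightarrow> ('j \<times> 'b) rel" where
  "colim_gen D = {((i, x), (j, mor D i j h x)) | i j h x.
     i \<in> idx D \<and> j \<in> idx D \<and> h \<in> arr D i j \<and> x \<in> pts (spc D i)}"

definition colim_rel :: "('j, 'm, 'b) ep_diagram \<Rightarrow> ('j \<times> 'b) rel" where
  "colim_rel D = Restr ((colim_gen D \<union> (colim_gen D)\<inverse>)\<^sup>*) (colim_sum D)"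

definition colim_pts :: "('j, 'm, 'b) ep_diagram \<Rightarrow> ('j \<times> 'b) set set" where
  "colim_pts D = colim_sum D // colim_rel D"

definition colim_in :: "('j, 'm, 'b) ep_diagram \<Rightarrow> 'j \<Rightarrow> 'b \<Rightarrow> ('j \<times> 'b) set" where
  "colim_in D j = (\<lambda>x\<in>pts (spc D j). colim_rel D `` {(j, x)})"

definition colim_metrics ::
  "('j, 'm, 'b) ep_diagram \<Rightarrow> (('j \<times> 'b) set \<Rightarrow> ('j \<times> 'b) set \<Rightarrow> ennreal) set" where
  "colim_metrics D = {\<delta>. ep_metric \<lparr>pts = colim_pts D, dst = \<delta>\<rparr> \<and>
     (\<forall>j\<in>idx D. ep_map (spc D j) \<lparr>pts = colim_pts D, dst = \<delta>\<rparr> (colim_in D j))}"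

definition ep_colim :: "('j, 'm, 'b) ep_diagram \<Rightarrow> ('j \<times> 'b) set epms" where
  "ep_colim D = \<lparr>pts = colim_pts D, dst = (\<lambda>A B. SUP \<delta>\<in>colim_metrics D. \<delta> A B)\<rparr>"

(* The map out of the colimit induced by a cocone c: the value at a class A is the common value of
   c on the representatives of A. *)
definition colim_desc ::
  "('j, 'm, 'b) ep_diagram \<Rightarrow> ('j \<Rightarrow> 'b \<Rightarrow> 'c) \<Rightarrow> ('j \<times> 'b) set \<Rightarrow> 'c" where
  "colim_desc D c = (\<lambda>A\<in>colim_pts D. the_elem ((\<lambda>(j, x). c j x) ` A))"

lemma colim_rel_equiv: "equiv (colim_sum D) (colim_rel D)"
proof (rule equivI)
  show "colim_rel D \<subseteq> colim_sum D \<times> colim_sum D"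
    by (auto simp: colim_rel_def)
  show "refl_on (colim_sum D) (colim_rel D)"
    by (auto simp: refl_on_def colim_rel_def)
  have "sym ((colim_gen D \<union> (colim_gen D)\<inverse>)\<^sup>*)"
    by (rule sym_rtrancl) (auto simp: sym_def)
  then show "sym (colim_rel D)"
    by (auto simp: sym_def colim_rel_def)
  show "trans (colim_rel D)"
    unfolding colim_rel_def trans_def by (auto intro: rtrancl_trans)
qed

lemma colim_in_in:
  assumes "j \<in> idx D" "x \<in> pts (spc D j)"
  shows "colim_in D j x \<in> colim_pts D"
  using assms by (auto simp: colim_in_def colim_pts_def colim_sum_def intro!: quotientI)

lemma colim_pts_cases:
  assumes "A \<in> colim_pts D"
  obtains j x where "j \<in> idx D" "x \<in> pts (spc D j)" "A = colim_in D j x"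
  using assms by (auto simp: colim_pts_def colim_in_def colim_sum_def elim!: quotientE)

lemma colim_in_mor:
  assumes D: "is_ep_diagram D" and ij: "i \<in> idx D" "j \<in> idx D" "h \<in> arr D i j"
    and x: "x \<in> pts (spc D i)"
  shows "colim_in D j (mor D i j h x) = colim_in D i x"
proof -
  have y: "mor D i j h x \<in> pts (spc D j)"
    using D ij x by (auto simp: is_ep_diagram_def ep_map_def PiE_iff)
  have "((i, x), (j, mor D i j h x)) \<in> colim_gen D"
    using ij x by (auto simp: colim_gen_def)
  then have "((i, x), (j, mor D i j h x)) \<in> colim_rel D"
    using ij x y by (auto simp: colim_rel_def colim_sum_def)
  then show ?thesis
    using x y equiv_class_eq[OF colim_rel_equiv] by (fastforce simp: colim_in_def)
qed

lemma ep_colim_metric: "ep_metric (ep_colim D)"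
proof -
  let ?d = "\<lambda>A B. SUP \<delta>\<in>colim_metrics D. \<delta> A B"
  have m: "ep_metric \<lparr>pts = colim_pts D, dst = \<delta>\<rparr>" if "\<delta> \<in> colim_metrics D" for \<delta>
    using that by (simp add: colim_metrics_def)
  have "?d A A = 0" if "A \<in> colim_pts D" for A
  proof -
    have "?d A A \<le> 0"
      by (rule SUP_least) (use m that in \<open>auto simp: ep_metric_def\<close>)
    then show ?thesis by simp
  qed
  moreover have "?d A B = ?d B A" if "A \<in> colim_pts D" "B \<in> colim_pts D" for A B
    by (rule SUP_cong) (use m that in \<open>auto simp: ep_metric_def\<close>)
  moreover have "?d A C \<le> ?d A B + ?d B C"
    if "A \<in> colim_pts D" "B \<in> colim_pts D" "C \<in> colim_pts D" for A B C
  proof (rule SUP_least)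
    fix \<delta> assume \<delta>: "\<delta> \<in> colim_metrics D"
    have "\<delta> A C \<le> \<delta> A B + \<delta> B C"
      using m[OF \<delta>] that by (auto simp: ep_metric_def)
    also have "\<dots> \<le> ?d A B + ?d B C"
      by (intro add_mono SUP_upper \<delta>)
    finally show "\<delta> A C \<le> ?d A B + ?d B C" .
  qed
  ultimately show ?thesis
    by (simp add: ep_metric_def ep_colim_def)
qed

lemma ep_colim_cocone:
  assumes D: "is_ep_diagram D"
  shows "ep_cocone D (ep_colim D) (colim_in D)"
proof -
  have "ep_map (spc D j) (ep_colim D) (colim_in D j)" if j: "j \<in> idx D" for j
    unfolding ep_map_def
  proof (intro conjI ballI)
    show "colim_in D j \<in> pts (spc D j) \<rightarrow>\<^sub>E pts (ep_colim D)"
      using j colim_in_in[OF j] by (auto simp: ep_colim_def colim_in_def)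
    fix x y assume "x \<in> pts (spc D j)" "y \<in> pts (spc D j)"
    then show "dst (ep_colim D) (colim_in D j x) (colim_in D j y) \<le> dst (spc D j) x y"
      using j unfolding ep_colim_def
      by (auto simp: colim_metrics_def ep_map_def intro!: SUP_least)
  qed
  with colim_in_mor[OF D] show ?thesis
    by (auto simp: ep_cocone_def)
qed

lemma colim_desc_in:
  assumes c: "ep_cocone D Z c" and D: "is_ep_diagram D"
    and j: "j \<in> idx D" and x: "x \<in> pts (spc D j)"
  shows "colim_desc D c (colim_in D j x) = c j x"
proof -
  let ?f = "\<lambda>(j, x). c j x"
  have gen: "?f p = ?f q" if "(p, q) \<in> colim_gen D" for p q
    using that c by (fastforce simp: colim_gen_def ep_cocone_def)
  have "?f p = ?f q" if "(p, q) \<in> (colim_gen D \<union> (colim_gen D)\<inverse>)\<^sup>*" for p q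
    using that by induction (use gen in fastforce)+
  then have rel: "?f p = ?f q" if "(p, q) \<in> colim_rel D" for p q
    using that by (auto simp: colim_rel_def)
  have self: "(j, x) \<in> colim_in D j x"
    using j x equiv_class_self[OF colim_rel_equiv, of "(j, x)" D]
    by (auto simp: colim_in_def colim_sum_def)
  have "?f q = c j x" if "q \<in> colim_in D j x" for q
    using rel[of "(j, x)" q] that x by (auto simp: colim_in_def)
  then have "?f ` colim_in D j x = {c j x}"
    using self by (auto simp: image_iff intro!: bexI[of _ "(j, x)"])
  then show ?thesis
    using colim_in_in[OF j x] by (simp add: colim_desc_def)
qed

lemma colim_desc_map:
  assumes Z: "ep_metric Z" and c: "ep_cocone D Z c" and D: "is_ep_diagram D"
  shows "ep_map (ep_colim D) Z (colim_desc D c)"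
proof -
  let ?u = "colim_desc D c"
  have u: "?u A \<in> pts Z" if "A \<in> colim_pts D" for A
    using that
  proof (rule colim_pts_cases)
    fix j x assume "j \<in> idx D" "x \<in> pts (spc D j)" "A = colim_in D j x"
    then show ?thesis
      using colim_desc_in[OF c D] c by (auto simp: ep_cocone_def ep_map_def)
  qed
  define \<delta> where "\<delta> A B = dst Z (?u A) (?u B)" for A B
  have "\<delta> \<in> colim_metrics D"
    unfolding colim_metrics_def mem_Collect_eq
  proof (intro conjI ballI)
    show "ep_metric \<lparr>pts = colim_pts D, dst = \<delta>\<rparr>"
      unfolding ep_metric_def \<delta>_def using Z[unfolded ep_metric_def] u by (simp; blast)
    fix j assume j: "j \<in> idx D"
    then have "ep_map (spc D j) Z (c j)"
      using c by (auto simp: ep_cocone_def)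
    then show "ep_map (spc D j) \<lparr>pts = colim_pts D, dst = \<delta>\<rparr> (colim_in D j)"
      using colim_in_in[OF j] colim_desc_in[OF c D j]
      by (auto simp: ep_map_def \<delta>_def colim_in_def)
  qed
  then have "\<delta> A B \<le> dst (ep_colim D) A B" for A B
    by (auto simp: ep_colim_def intro!: SUP_upper2[of \<delta>])
  moreover have "?u \<in> pts (ep_colim D) \<rightarrow>\<^sub>E pts Z"
    using u by (auto simp: ep_colim_def colim_desc_def)
  ultimately show ?thesis
    by (simp add: ep_map_def \<delta>_def)
qed

lemma ep_colim_universal:
  assumes Z: "ep_metric Z" and c: "ep_cocone D Z c" and D: "is_ep_diagram D"
  shows "\<exists>!u. ep_map (ep_colim D) Z u \<and>
    (\<forall>j\<in>idx D. \<forall>x\<in>pts (spc D j). u (colim_in D j x) = c j x)"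
proof (rule ex1I)
  show "ep_map (ep_colim D) Z (colim_desc D c) \<and>
    (\<forall>j\<in>idx D. \<forall>x\<in>pts (spc D j). colim_desc D c (colim_in D j x) = c j x)"
    using colim_desc_map[OF assms] colim_desc_in[OF c D] by auto
  fix u assume u: "ep_map (ep_colim D) Z u \<and>
    (\<forall>j\<in>idx D. \<forall>x\<in>pts (spc D j). u (colim_in D j x) = c j x)"
  show "u = colim_desc D c"
  proof
    fix A show "u A = colim_desc D c A"
    proof (cases "A \<in> colim_pts D")
      case True
      then show ?thesis
      proof (rule colim_pts_cases)
        fix j x assume "j \<in> idx D" "x \<in> pts (spc D j)" "A = colim_in D j x"
        then show ?thesis
          using u colim_desc_in[OF c D] by simp
      qed
    next
      case False
      moreover have "u \<in> colim_pts D \<rightarrow>\<^sub>E pts Z"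
        using u by (simp add: ep_map_def ep_colim_def)
      ultimately have "u A = undefined"
        by (blast intro: PiE_arb)
      with False show ?thesis
        by (simp add: colim_desc_def)
    qed
  qed
qed


section \<open>Simplicial sets\<close>

definition ord_hom :: "nat \<Rightarrow> nat \<Rightarrow> (nat \<Rightarrow> nat) set" where
  "ord_hom m n = {\<theta> \<in> {0..m} \<rightarrow>\<^sub>E {0..n}. mono_on {0..m} \<theta>}"

(* act K m n \<theta> : K_n \<rightarrow> K_m is the action of an ordinal number map \<theta> : [m] \<rightarrow> [n]. *)
record 'a sset =
  splx :: "nat \<Rightarrow> 'a set"
  act :: "nat \<Rightarrow> nat \<Rightarrow> (nat \<Rightarrow> nat) \<Rightarrow> 'a \<Rightarrow> 'a"

definition simplicial_set :: "'a sset \<Rightarrow> bool" where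
  "simplicial_set K \<longleftrightarrow>
     (\<forall>m n. \<forall>\<theta>\<in>ord_hom m n. act K m n \<theta> \<in> splx K n \<rightarrow> splx K m) \<and>
     (\<forall>n. \<forall>x\<in>splx K n. act K n n (restrict id {0..n}) x = x) \<and>
     (\<forall>k m n. \<forall>\<phi>\<in>ord_hom k m. \<forall>\<theta>\<in>ord_hom m n. \<forall>x\<in>splx K n.
        act K k n (compose {0..k} \<theta> \<phi>) x = act K k m \<phi> (act K m n \<theta> x))"

definition sset_map :: "'a sset \<Rightarrow> 'b sset \<Rightarrow> (nat \<Rightarrow> 'a \<Rightarrow> 'b) \<Rightarrow> bool" where
  "sset_map K L f \<longleftrightarrow>
     (\<forall>n. f n \<in> splx K n \<rightarrow>\<^sub>E splx L n) \<and>
     (\<forall>m n. \<forall>\<theta>\<in>ord_hom m n. \<forall>x\<in>splx K n. f m (act K m n \<theta> x) = act L m n \<theta> (f n x))"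

definition std_simplex :: "nat \<Rightarrow> (nat \<Rightarrow> nat) sset" where
  "std_simplex n = \<lparr>splx = (\<lambda>m. ord_hom m n), act = (\<lambda>k m \<theta> x. compose {0..k} x \<theta>)\<rparr>"

definition vertex :: "nat \<Rightarrow> nat \<Rightarrow> nat" where
  "vertex i = (\<lambda>_\<in>{0..0::nat}. i)"

(* The subcomplex generated by the simplices of dimension at most r. *)
definition skel :: "nat \<Rightarrow> 'a sset \<Rightarrow> 'a sset" where
  "skel r K = K\<lparr>splx := \<lambda>n. {act K n k \<theta> x | k \<theta> x. k \<le> r \<and> \<theta> \<in> ord_hom n k \<and> x \<in> splx K k}\<rparr>"


section \<open>Diagrams of simplicial sets indexed by the extended half line\<close>

record 'a sdiag =
  ob :: "ennreal \<Rightarrow> 'a sset"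
  tr :: "ennreal \<Rightarrow> ennreal \<Rightarrow> nat \<Rightarrow> 'a \<Rightarrow> 'a"

definition is_sdiag :: "'a sdiag \<Rightarrow> bool" where
  "is_sdiag X \<longleftrightarrow>
     (\<forall>s. simplicial_set (ob X s)) \<and>
     (\<forall>s t. s \<le> t \<longrightarrow> sset_map (ob X s) (ob X t) (tr X s t)) \<and>
     (\<forall>s n. \<forall>x\<in>splx (ob X s) n. tr X s s n x = x) \<and>
     (\<forall>s t u n. s \<le> t \<longrightarrow> t \<le> u \<longrightarrow>
        (\<forall>x\<in>splx (ob X s) n. tr X s u n x = tr X t u n (tr X s t n x)))"

definition sdiag_map :: "'a sdiag \<Rightarrow> 'b sdiag \<Rightarrow> (ennreal \<Rightarrow> nat \<Rightarrow> 'a \<Rightarrow> 'b) \<Rightarrow> bool" where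
  "sdiag_map X Y \<eta> \<longleftrightarrow>
     (\<forall>s. sset_map (ob X s) (ob Y s) (\<eta> s)) \<and>
     (\<forall>s t n. s \<le> t \<longrightarrow> (\<forall>x\<in>splx (ob X s) n. \<eta> t n (tr X s t n x) = tr Y s t n (\<eta> s n x)))"

(* Composite of \<phi> : X \<rightarrow> Y with a map \<psi> out of Y. *)
definition sdiag_comp ::
  "'a sdiag \<Rightarrow> (ennreal \<Rightarrow> nat \<Rightarrow> 'b \<Rightarrow> 'c) \<Rightarrow> (ennreal \<Rightarrow> nat \<Rightarrow> 'a \<Rightarrow> 'b) \<Rightarrow>
   (ennreal \<Rightarrow> nat \<Rightarrow> 'a \<Rightarrow> 'c)" where
  "sdiag_comp X \<psi> \<phi> = (\<lambda>s n. compose (splx (ob X s) n) (\<psi> s n) (\<phi> s n))"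

definition sk_diag :: "nat \<Rightarrow> 'a sdiag \<Rightarrow> 'a sdiag" where
  "sk_diag r X = \<lparr>ob = (\<lambda>s. skel r (ob X s)),
     tr = (\<lambda>s t n. restrict (tr X s t n) (splx (skel r (ob X s)) n))\<rparr>"

(* The family of identity functions on the simplices of A, for a subdiagram A of a diagram. *)
definition sdiag_incl :: "'a sdiag \<Rightarrow> ennreal \<Rightarrow> nat \<Rightarrow> 'a \<Rightarrow> 'a" where
  "sdiag_incl A = (\<lambda>s n. restrict id (splx (ob A s) n))"

definition L_diag :: "ennreal \<Rightarrow> 'a sset \<Rightarrow> 'a sdiag" where
  "L_diag s K =
     \<lparr>ob = (\<lambda>t. if s \<le> t then K else K\<lparr>splx := \<lambda>_. {}\<rparr>),
      tr = (\<lambda>t u n. restrict id (if s \<le> t then splx K n else {}))\<rparr>"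

abbreviation L_simplex :: "ennreal \<Rightarrow> nat \<Rightarrow> (nat \<Rightarrow> nat) sdiag" where
  "L_simplex s n \<equiv> L_diag s (std_simplex n)"


section \<open>The category of simplices and the realization\<close>

(* An object (s, n, f) is a map f : L_s \<Delta>^n \<rightarrow> X. *)
type_synonym 'a simplex_over = "ennreal \<times> nat \<times> (ennreal \<Rightarrow> nat \<Rightarrow> (nat \<Rightarrow> nat) \<Rightarrow> 'a)"

type_synonym simplex_arr = "ennreal \<Rightarrow> nat \<Rightarrow> (nat \<Rightarrow> nat) \<Rightarrow> nat \<Rightarrow> nat"

definition simplices :: "'a sdiag \<Rightarrow> 'a simplex_over set" where
  "simplices X = {(s, n, f). sdiag_map (L_simplex s n) X f}"

definition simplices_hom :: "'a simplex_over \<Rightarrow> 'a simplex_over \<Rightarrow> simplex_arr set" where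
  "simplices_hom = (\<lambda>(t, m, f) (s, n, g).
     {\<phi>. sdiag_map (L_simplex t m) (L_simplex s n) \<phi> \<and> sdiag_comp (L_simplex t m) g \<phi> = f})"

definition U_space :: "ennreal \<Rightarrow> nat \<Rightarrow> nat epms" where
  "U_space s n = \<lparr>pts = {0..n}, dst = (\<lambda>i j. if i = j then 0 else s)\<rparr>"

(* The vertex function of \<phi> : L_t \<Delta>^m \<rightarrow> L_s \<Delta>^n. The stage t is the first one at
   which L_t \<Delta>^m is nonempty, and \<phi> is determined by its component there. *)
definition vertex_fun :: "ennreal \<Rightarrow> nat \<Rightarrow> simplex_arr \<Rightarrow> nat \<Rightarrow> nat" where
  "vertex_fun t m \<phi> = (\<lambda>i\<in>{0..m}. \<phi> t 0 (vertex i) 0)"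

definition U_diagram :: "'a sdiag \<Rightarrow> ('a simplex_over, simplex_arr, nat) ep_diagram" where
  "U_diagram X = \<lparr>idx = simplices X, arr = simplices_hom,
     spc = (\<lambda>(s, n, f). U_space s n),
     mor = (\<lambda>(t, m, f) (s, n, g) \<phi>. vertex_fun t m \<phi>)\<rparr>"

definition realization :: "'a sdiag \<Rightarrow> ('a simplex_over \<times> nat) set epms" where
  "realization X = ep_colim (U_diagram X)"

definition simplices_map ::
  "(ennreal \<Rightarrow> nat \<Rightarrow> 'a \<Rightarrow> 'b) \<Rightarrow> 'a simplex_over \<Rightarrow> 'b simplex_over" where
  "simplices_map \<eta> = (\<lambda>(s, n, f). (s, n, sdiag_comp (L_simplex s n) \<eta> f))"

(* The map of realizations induced by \<eta> : X \<rightarrow> Y is the map out of the colimit given by the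
   cocone whose component at f : L_s \<Delta>^n \<rightarrow> X is the canonical map at \<eta> \<circ> f. *)
definition realization_map ::
  "'a sdiag \<Rightarrow> 'b sdiag \<Rightarrow> (ennreal \<Rightarrow> nat \<Rightarrow> 'a \<Rightarrow> 'b) \<Rightarrow>
   ('a simplex_over \<times> nat) set \<Rightarrow> ('b simplex_over \<times> nat) set" where
  "realization_map X Y \<eta> =
     colim_desc (U_diagram X) (\<lambda>j. colim_in (U_diagram Y) (simplices_map \<eta> j))"

lemma act_closed:
  assumes "simplicial_set K" "\<theta> \<in> ord_hom m n" "x \<in> splx K n"
  shows "act K m n \<theta> x \<in> splx K m"
proof -
  have "act K m n \<theta> \<in> splx K n \<rightarrow> splx K m"
    using assms by (simp add: simplicial_set_def)
  then show ?thesis using assms(3) by (rule funcset_mem)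
qed

lemma sset_mapD:
  assumes "sset_map K L f"
  shows "f n \<in> splx K n \<rightarrow>\<^sub>E splx L n"
    and "x \<in> splx K n \<Longrightarrow> f n x \<in> splx L n"
    and "\<theta> \<in> ord_hom m n \<Longrightarrow> x \<in> splx K n \<Longrightarrow> f m (act K m n \<theta> x) = act L m n \<theta> (f n x)"
  using assms unfolding sset_map_def by (simp_all add: PiE_iff)

lemma sdiagD:
  assumes "is_sdiag X"
  shows sdiag_simplicial_set: "simplicial_set (ob X s)"
    and sdiag_tr_map: "s \<le> t \<Longrightarrow> sset_map (ob X s) (ob X t) (tr X s t)"
    and sdiag_tr_id: "x \<in> splx (ob X s) n \<Longrightarrow> tr X s s n x = x"
    and sdiag_tr_comp: "s \<le> t \<Longrightarrow> t \<le> u \<Longrightarrow> x \<in> splx (ob X s) n \<Longrightarrow>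
      tr X s u n x = tr X t u n (tr X s t n x)"
proof -
  note D = assms[unfolded is_sdiag_def]
  show "simplicial_set (ob X s)"
    by (rule D[THEN conjunct1, rule_format])
  show "s \<le> t \<Longrightarrow> sset_map (ob X s) (ob X t) (tr X s t)"
    by (rule D[THEN conjunct2, THEN conjunct1, rule_format])
  show "x \<in> splx (ob X s) n \<Longrightarrow> tr X s s n x = x"
    by (rule D[THEN conjunct2, THEN conjunct2, THEN conjunct1, rule_format])
  show "s \<le> t \<Longrightarrow> t \<le> u \<Longrightarrow> x \<in> splx (ob X s) n \<Longrightarrow>
      tr X s u n x = tr X t u n (tr X s t n x)"
    by (rule D[THEN conjunct2, THEN conjunct2, THEN conjunct2, rule_format])
qed

lemma sdiag_mapD:
  assumes "sdiag_map X Y \<eta>"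
  shows "sset_map (ob X s) (ob Y s) (\<eta> s)"
    and "x \<in> splx (ob X s) n \<Longrightarrow> \<eta> s n x \<in> splx (ob Y s) n"
    and "s \<le> t \<Longrightarrow> x \<in> splx (ob X s) n \<Longrightarrow> \<eta> t n (tr X s t n x) = tr Y s t n (\<eta> s n x)"
proof -
  note D = assms[unfolded sdiag_map_def]
  show f: "sset_map (ob X s) (ob Y s) (\<eta> s)"
    by (rule D[THEN conjunct1, rule_format])
  show "x \<in> splx (ob X s) n \<Longrightarrow> \<eta> s n x \<in> splx (ob Y s) n"
    by (rule sset_mapD(2)[OF f])
  show "s \<le> t \<Longrightarrow> x \<in> splx (ob X s) n \<Longrightarrow> \<eta> t n (tr X s t n x) = tr Y s t n (\<eta> s n x)"
    by (rule D[THEN conjunct2, rule_format])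
qed

lemma sdiag_comp_map:
  assumes X: "is_sdiag X" and \<phi>: "sdiag_map X Y \<phi>" and \<psi>: "sdiag_map Y Z \<psi>"
  shows "sdiag_map X Z (sdiag_comp X \<psi> \<phi>)"
  unfolding sdiag_map_def sset_map_def
proof (intro conjI allI impI ballI)
  show "sdiag_comp X \<psi> \<phi> s n \<in> splx (ob X s) n \<rightarrow>\<^sub>E splx (ob Z s) n" for s n
    using sdiag_mapD(2)[OF \<phi>] sdiag_mapD(2)[OF \<psi>] by (simp add: sdiag_comp_def compose_def)
  fix s m n \<theta> x assume "\<theta> \<in> ord_hom m n" "x \<in> splx (ob X s) n"
  then show "sdiag_comp X \<psi> \<phi> s m (act (ob X s) m n \<theta> x) =
      act (ob Z s) m n \<theta> (sdiag_comp X \<psi> \<phi> s n x)"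
    using act_closed[OF sdiag_simplicial_set[OF X]] sdiag_mapD(2)[OF \<phi>]
    by (simp add: sdiag_comp_def compose_def
        sset_mapD(3)[OF sdiag_mapD(1)[OF \<phi>]] sset_mapD(3)[OF sdiag_mapD(1)[OF \<psi>]])
next
  fix s t n x assume "s \<le> t" "x \<in> splx (ob X s) n"
  then show "sdiag_comp X \<psi> \<phi> t n (tr X s t n x) = tr Z s t n (sdiag_comp X \<psi> \<phi> s n x)"
    using sset_mapD(2)[OF sdiag_tr_map[OF X]] sdiag_mapD(2)[OF \<phi>]
    by (simp add: sdiag_comp_def compose_def sdiag_mapD(3)[OF \<phi>] sdiag_mapD(3)[OF \<psi>])
qed

lemma ord_hom_compose:
  assumes \<phi>: "\<phi> \<in> ord_hom k m" and \<theta>: "\<theta> \<in> ord_hom m n"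
  shows "compose {0..k} \<theta> \<phi> \<in> ord_hom k n"
proof -
  have a: "\<phi> i \<in> {0..m}" if "i \<in> {0..k}" for i
    using \<phi> that by (auto simp: ord_hom_def)
  have b: "\<theta> i \<in> {0..n}" if "i \<in> {0..m}" for i
    using \<theta> that by (auto simp: ord_hom_def)
  have c: "\<phi> i \<le> \<phi> j" if "i \<in> {0..k}" "j \<in> {0..k}" "i \<le> j" for i j
    using \<phi> that by (auto simp: ord_hom_def mono_on_def)
  have d: "\<theta> i \<le> \<theta> j" if "i \<in> {0..m}" "j \<in> {0..m}" "i \<le> j" for i j
    using \<theta> that by (auto simp: ord_hom_def mono_on_def)
  have "mono_on {0..k} (compose {0..k} \<theta> \<phi>)"
    by (intro mono_onI) (simp only: compose_eq a c d)
  moreover have "compose {0..k} \<theta> \<phi> \<in> {0..k} \<rightarrow>\<^sub>E {0..n}"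
    unfolding compose_def by (intro restrict_PiE_iff[THEN iffD2] ballI a b)
  ultimately show ?thesis
    by (simp add: ord_hom_def)
qed

lemma std_simplex_sset: "simplicial_set (std_simplex n)"
  unfolding simplicial_set_def
proof (intro conjI allI ballI funcsetI)
  show "act (std_simplex n) m k \<theta> x \<in> splx (std_simplex n) m"
    if "\<theta> \<in> ord_hom m k" "x \<in> splx (std_simplex n) k" for m k \<theta> x
    using ord_hom_compose[OF that(1)] that(2) by (simp add: std_simplex_def)
  show "act (std_simplex n) k k (restrict id {0..k}) x = x"
    if "x \<in> splx (std_simplex n) k" for k x
  proof -
    have "x \<in> extensional {0..k}"
      using that by (simp add: std_simplex_def ord_hom_def PiE_iff)
    then show ?thesis
      by (auto simp: std_simplex_def compose_def extensional_def)
  qed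
  show "act (std_simplex n) k q (compose {0..k} \<theta> \<phi>) x =
      act (std_simplex n) k m \<phi> (act (std_simplex n) m q \<theta> x)"
    if \<phi>: "\<phi> \<in> ord_hom k m" for k m q \<phi> \<theta> x
  proof -
    have "\<phi> i \<le> m" if "i \<le> k" for i
      using \<phi> that by (auto simp: ord_hom_def)
    then show ?thesis
      by (auto simp: std_simplex_def compose_def)
  qed
qed

lemma L_diag_sdiag: "simplicial_set K \<Longrightarrow> is_sdiag (L_diag s K)"
  unfolding is_sdiag_def
  by (auto simp: L_diag_def simplicial_set_def sset_map_def)

lemma U_space_metric: "ep_metric (U_space s n)"
  by (auto simp: ep_metric_def U_space_def)

lemma vertex_in: "i \<le> m \<Longrightarrow> vertex i \<in> ord_hom 0 m"
  by (simp add: vertex_def ord_hom_def mono_on_def)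

lemma vertex_fun_map:
  assumes \<phi>: "sdiag_map (L_simplex t m) (L_simplex s n) \<phi>"
  shows "ep_map (U_space t m) (U_space s n) (vertex_fun t m \<phi>)"
proof -
  have w: "\<phi> t 0 (vertex i) \<in> splx (ob (L_simplex s n) t) 0" if "i \<le> m" for i
    by (rule sdiag_mapD(2)[OF \<phi>])
      (simp add: L_diag_def std_simplex_def vertex_in[OF that])
  have st: "s \<le> t"
    using w[of 0] by (simp add: L_diag_def split: if_splits)
  have "\<phi> t 0 (vertex i) \<in> ord_hom 0 n" if "i \<le> m" for i
    using w[OF that] st by (simp add: L_diag_def std_simplex_def)
  then have "\<phi> t 0 (vertex i) 0 \<in> {0..n}" if "i \<le> m" for i
    using that unfolding ord_hom_def by fastforce
  then show ?thesis
    using st by (simp add: ep_map_def U_space_def vertex_fun_def)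
qed

lemma U_diagram_simps:
  "idx (U_diagram X) = simplices X"
  "arr (U_diagram X) = simplices_hom"
  "spc (U_diagram X) (s, n, f) = U_space s n"
  "mor (U_diagram X) (t, m, f) (s, n, g) \<phi> = vertex_fun t m \<phi>"
  by (simp_all add: U_diagram_def)

lemma U_diagram_ep_diagram:
  fixes X :: "'a sdiag"
  shows "is_ep_diagram (U_diagram X)"
  unfolding is_ep_diagram_def U_diagram_simps(1,2)
proof (intro conjI ballI)
  fix j assume "j \<in> simplices X"
  show "ep_metric (spc (U_diagram X) j)"
    by (cases j) (simp add: U_diagram_simps U_space_metric)
next
  fix i j :: "'a simplex_over" and \<phi> assume h: "\<phi> \<in> simplices_hom i j"
  obtain t m f s n g where ij: "i = (t, m, f)" "j = (s, n, g)"
    by (metis prod_cases3)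
  have "sdiag_map (L_simplex t m) (L_simplex s n) \<phi>"
    using h by (simp add: ij simplices_hom_def)
  then show "ep_map (spc (U_diagram X) i) (spc (U_diagram X) j) (mor (U_diagram X) i j \<phi>)"
    by (simp add: ij U_diagram_simps vertex_fun_map)
qed

lemma realization_map_cocone:
  assumes \<eta>: "sdiag_map X Y \<eta>"
  shows "ep_cocone (U_diagram X) (realization Y)
    (\<lambda>j. colim_in (U_diagram Y) (simplices_map \<eta> j))"
proof -
  have L: "is_sdiag (L_simplex s n)" for s n
    by (rule L_diag_sdiag[OF std_simplex_sset])
  have obj: "simplices_map \<eta> j \<in> simplices Y" if "j \<in> simplices X" for j
    using that sdiag_comp_map[OF L _ \<eta>] by (auto simp: simplices_def simplices_map_def)
  have hom: "h \<in> simplices_hom (simplices_map \<eta> i) (simplices_map \<eta> j)"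
    if "h \<in> simplices_hom i j" for h i j
  proof -
    obtain t m f s n g where ij: "i = (t, m, f)" "j = (s, n, g)"
      by (metis prod_cases3)
    have h: "sdiag_map (L_simplex t m) (L_simplex s n) h" "sdiag_comp (L_simplex t m) g h = f"
      using that by (auto simp: ij simplices_hom_def)
    have m: "h u k x \<in> splx (ob (L_simplex s n) u) k" if "x \<in> splx (ob (L_simplex t m) u) k" for u k x
      by (rule sdiag_mapD(2)[OF h(1) that])
    have "sdiag_comp (L_simplex t m) (sdiag_comp (L_simplex s n) \<eta> g) h =
        sdiag_comp (L_simplex t m) \<eta> f"
      unfolding h(2)[symmetric] by (auto simp: sdiag_comp_def compose_def m intro!: ext)
    with h(1) show ?thesis
      by (simp add: ij simplices_hom_def simplices_map_def)
  qed
  have spc: "spc (U_diagram Y) (simplices_map \<eta> j) = spc (U_diagram X) j" for j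
    by (simp add: U_diagram_def simplices_map_def split: prod.splits)
  have mor: "mor (U_diagram Y) (simplices_map \<eta> i) (simplices_map \<eta> j) h = mor (U_diagram X) i j h"
    for i j h
    by (simp add: U_diagram_def simplices_map_def split: prod.splits)
  have Y: "ep_cocone (U_diagram Y) (realization Y) (colim_in (U_diagram Y))"
    unfolding realization_def by (rule ep_colim_cocone[OF U_diagram_ep_diagram])
  show ?thesis
    unfolding ep_cocone_def U_diagram_simps(1,2)
  proof (intro conjI ballI)
    fix j assume "j \<in> simplices X"
    then show "ep_map (spc (U_diagram X) j) (realization Y)
        (colim_in (U_diagram Y) (simplices_map \<eta> j))"
      using Y obj by (metis ep_cocone_def U_diagram_simps(1) spc)
  next
    fix i j h x assume a: "i \<in> simplices X" "j \<in> simplices X" "h \<in> simplices_hom i j"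
      "x \<in> pts (spc (U_diagram X) i)"
    then show "colim_in (U_diagram Y) (simplices_map \<eta> j) (mor (U_diagram X) i j h x) =
        colim_in (U_diagram Y) (simplices_map \<eta> i) x"
      using Y obj[OF a(1)] obj[OF a(2)] hom[OF a(3)]
      unfolding ep_cocone_def U_diagram_simps(1,2) by (metis spc mor)
  qed
qed

lemma realization_map_ep_map:
  assumes \<eta>: "sdiag_map X Y \<eta>"
  shows "ep_map (realization X) (realization Y) (realization_map X Y \<eta>)"
    and "j \<in> simplices X \<Longrightarrow> x \<in> pts (spc (U_diagram X) j) \<Longrightarrow>
      realization_map X Y \<eta> (colim_in (U_diagram X) j x) =
      colim_in (U_diagram Y) (simplices_map \<eta> j) x"
proof -
  note c = realization_map_cocone[OF \<eta>]
  have Z: "ep_metric (realization Y)"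
    unfolding realization_def by (rule ep_colim_metric)
  show "ep_map (realization X) (realization Y) (realization_map X Y \<eta>)"
    unfolding realization_map_def realization_def[of X]
    by (rule colim_desc_map[OF Z c U_diagram_ep_diagram])
  show "j \<in> simplices X \<Longrightarrow> x \<in> pts (spc (U_diagram X) j) \<Longrightarrow>
      realization_map X Y \<eta> (colim_in (U_diagram X) j x) =
      colim_in (U_diagram Y) (simplices_map \<eta> j) x"
    unfolding realization_map_def
    by (rule colim_desc_in[OF c U_diagram_ep_diagram]) (simp_all add: U_diagram_simps)
qed

lemma skel_simplices:
  assumes K: "simplicial_set K" and x: "x \<in> splx (skel r K) n"
  shows "x \<in> splx K n" and "\<theta> \<in> ord_hom m n \<Longrightarrow> act K m n \<theta> x \<in> splx (skel r K) m"
proof -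
  obtain k \<sigma> y where y: "k \<le> r" "\<sigma> \<in> ord_hom n k" "y \<in> splx K k" "x = act K n k \<sigma> y"
    using x by (auto simp: skel_def)
  show "x \<in> splx K n"
    using K y by (auto intro: act_closed)
  assume \<theta>: "\<theta> \<in> ord_hom m n"
  have "act K m n \<theta> x = act K m k (compose {0..m} \<sigma> \<theta>) y"
    using K y \<theta> by (auto simp: simplicial_set_def)
  then show "act K m n \<theta> x \<in> splx (skel r K) m"
    using y ord_hom_compose[OF \<theta> y(2)] by (auto simp: skel_def)
qed

lemma skel_sset:
  assumes K: "simplicial_set K"
  shows "simplicial_set (skel r K)"
proof -
  have act: "act (skel r K) = act K"
    by (simp add: skel_def)
  have sub: "x \<in> splx K n" if "x \<in> splx (skel r K) n" for x n
    using skel_simplices(1)[OF K that] .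
  show ?thesis
    unfolding simplicial_set_def act
  proof (intro conjI allI ballI funcsetI)
    show "act K m n \<theta> x \<in> splx (skel r K) m"
      if "\<theta> \<in> ord_hom m n" "x \<in> splx (skel r K) n" for m n \<theta> x
      by (rule skel_simplices(2)[OF K that(2,1)])
  qed (use K sub in \<open>auto simp: simplicial_set_def\<close>)
qed

lemma skel_map:
  assumes K: "simplicial_set K" and f: "sset_map K L f" and x: "x \<in> splx (skel r K) n"
  shows "f n x \<in> splx (skel r L) n"
proof -
  obtain k \<sigma> y where y: "k \<le> r" "\<sigma> \<in> ord_hom n k" "y \<in> splx K k" "x = act K n k \<sigma> y"
    using x by (auto simp: skel_def)
  have "f n x = act L n k \<sigma> (f k y)" "f k y \<in> splx L k"
    using f y by (auto simp: sset_map_def PiE_iff)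
  then show ?thesis
    using y by (auto simp: skel_def)
qed

lemma sk_diag_sdiag:
  assumes X: "is_sdiag X"
  shows "is_sdiag (sk_diag r X)"
proof -
  note K = sdiag_simplicial_set[OF X]
  note T = sdiag_tr_map[OF X]
  note sub = skel_simplices[OF K]
  note m = skel_map[OF K T]
  have act: "act (skel r L) = act L" for L :: "'a sset"
    by (simp add: skel_def)
  show ?thesis
    unfolding is_sdiag_def
  proof (intro conjI allI impI ballI)
    show "simplicial_set (ob (sk_diag r X) s)" for s
      by (simp add: sk_diag_def skel_sset[OF K])
    show "sset_map (ob (sk_diag r X) s) (ob (sk_diag r X) t) (tr (sk_diag r X) s t)"
      if "s \<le> t" for s t
      using m[OF that] sub
      by (auto simp: sk_diag_def sset_map_def act sset_mapD(3)[OF T[OF that]])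
    show "tr (sk_diag r X) s s n x = x" if "x \<in> splx (ob (sk_diag r X) s) n" for s n x
      using that sub(1) by (simp add: sk_diag_def sdiag_tr_id[OF X])
    show "tr (sk_diag r X) s u n x = tr (sk_diag r X) t u n (tr (sk_diag r X) s t n x)"
      if "s \<le> t" "t \<le> u" "x \<in> splx (ob (sk_diag r X) s) n" for s t u n x
      using that m[OF that(1)] sdiag_tr_comp[OF X that(1,2)] sub(1) by (simp add: sk_diag_def)
  qed
qed

lemma sk_diag_incl:
  assumes X: "is_sdiag X"
  shows "sdiag_map (sk_diag r X) X (sdiag_incl (sk_diag r X))"
proof -
  note K = sdiag_simplicial_set[OF X]
  note T = sdiag_tr_map[OF X]
  note sub = skel_simplices[OF K]
  note m = skel_map[OF K T]
  have act: "act (skel r L) = act L" for L :: "'a sset"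
    by (simp add: skel_def)
  show ?thesis
    using sub m by (auto simp: sdiag_map_def sset_map_def sdiag_incl_def sk_diag_def act)
qed

end

theory Submission
  imports Defs
begin

text \<open>
  Every point of the realization is represented by a vertex, that is, by an object
  \<open>L\<^sub>s \<Delta>\<^sup>0 \<rightarrow> X\<close>, and the distance of two vertices of a simplex
  \<open>L\<^sub>s \<Delta>\<^sup>n \<rightarrow> X\<close> is already bounded by \<open>s\<close> on the edge that joins them. Vertices and edges
  lie in the 1-skeleton, so sending the vertex \<open>i\<close> of \<open>f : L\<^sub>s \<Delta>\<^sup>n \<rightarrow> X\<close> to the class of
  the 0-simplex \<open>f i\<close> is a cocone with values in the realization of \<open>sk\<^sub>1 X\<close>. The induced map is
  inverse to the map induced by the inclusion.
\<close>

section \<open>Maps between the diagrams \<open>L_simplex t m\<close>\<close>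

text \<open>Postcomposition with \<open>\<theta>\<close> is the same formula for every target
  \<open>L_simplex s n\<close>, so \<open>s\<close> and \<open>n\<close> do not occur. Restricting
  to the simplices of the source makes the map extensional, as \<open>sset_map\<close>
  demands.\<close>

definition L_map :: "ennreal \<Rightarrow> nat \<Rightarrow> (nat \<Rightarrow> nat) \<Rightarrow> simplex_arr" where
  "L_map t m \<theta> = (\<lambda>u k. \<lambda>x\<in>splx (ob (L_simplex t m) u) k. compose {0..k} \<theta> x)"

abbreviation pull ::
  "ennreal \<Rightarrow> nat \<Rightarrow> (nat \<Rightarrow> nat) \<Rightarrow> (ennreal \<Rightarrow> nat \<Rightarrow> (nat \<Rightarrow> nat) \<Rightarrow> 'a) \<Rightarrow>
   ennreal \<Rightarrow> nat \<Rightarrow> (nat \<Rightarrow> nat) \<Rightarrow> 'a" where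
  "pull t m \<theta> f \<equiv> sdiag_comp (L_simplex t m) f (L_map t m \<theta>)"

lemma L_simplex_splx:
  "splx (ob (L_simplex s n) u) k = (if s \<le> u then ord_hom k n else {})"
  by (simp add: L_diag_def std_simplex_def)

lemma L_simplex_act:
  "act (ob (L_simplex s n) u) k l \<theta> x = compose {0..k} x \<theta>"
  by (simp add: L_diag_def std_simplex_def)

lemma L_simplex_tr:
  "s \<le> u \<Longrightarrow> x \<in> ord_hom k n \<Longrightarrow> tr (L_simplex s n) u v k x = x"
  by (simp add: L_diag_def std_simplex_def)

lemma L_simplex_sdiag: "is_sdiag (L_simplex s n)"
  by (rule L_diag_sdiag[OF std_simplex_sset])

lemma ord_hom_le: "\<theta> \<in> ord_hom m n \<Longrightarrow> i \<le> m \<Longrightarrow> \<theta> i \<le> n"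
  by (auto simp: ord_hom_def)

lemma ord_hom_extensional: "\<theta> \<in> ord_hom m n \<Longrightarrow> \<theta> \<in> extensional {0..m}"
  by (auto simp: ord_hom_def PiE_def)

lemma ord_hom_id: "restrict id {0..n} \<in> ord_hom n n"
  by (auto simp: ord_hom_def mono_on_def)

lemma ord_hom_id_compose: "\<theta> \<in> ord_hom m n \<Longrightarrow> compose {0..m} (restrict id {0..n}) \<theta> = \<theta>"
  using ord_hom_extensional[of \<theta> m n] ord_hom_le[of \<theta> m n]
  by (fastforce simp: compose_def extensional_def)

lemma ord_hom_compose_assoc:
  "x \<in> ord_hom k l \<Longrightarrow>
    compose {0..k} \<theta> (compose {0..k} \<phi> x) = compose {0..k} (compose {0..l} \<theta> \<phi>) x"
  using ord_hom_le[of x k l] by (auto simp: compose_def)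

lemma vertex_zero [simp]: "vertex i 0 = i"
  by (simp add: vertex_def)

lemma compose_vertex: "\<theta> \<in> ord_hom m n \<Longrightarrow> i \<le> m \<Longrightarrow> compose {0} \<theta> (vertex i) = vertex (\<theta> i)"
  by (auto simp: compose_def vertex_def)

lemma L_map_sdiag_map:
  assumes \<theta>: "\<theta> \<in> ord_hom m n" and st: "s \<le> t"
  shows "sdiag_map (L_simplex t m) (L_simplex s n) (L_map t m \<theta>)"
proof -
  have *: "compose {0..k} \<theta> x \<in> ord_hom k n" if "x \<in> ord_hom k m" for k x
    by (rule ord_hom_compose[OF that \<theta>])
  have **: "compose {0..k} y \<phi> \<in> ord_hom k m" if "\<phi> \<in> ord_hom k l" "y \<in> ord_hom l m" for k l y \<phi>
    by (rule ord_hom_compose[OF that])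
  show ?thesis
    unfolding sdiag_map_def sset_map_def
  proof (intro conjI allI impI ballI)
    show "L_map t m \<theta> u k \<in> splx (ob (L_simplex t m) u) k \<rightarrow>\<^sub>E splx (ob (L_simplex s n) u) k" for u k
      using st * by (auto simp: L_map_def L_simplex_splx)
  next
    fix u k l \<phi> x assume \<phi>: "\<phi> \<in> ord_hom k l" and x: "x \<in> splx (ob (L_simplex t m) u) l"
    then show "L_map t m \<theta> u k (act (ob (L_simplex t m) u) k l \<phi> x) =
        act (ob (L_simplex s n) u) k l \<phi> (L_map t m \<theta> u l x)"
      using ** by (simp add: L_map_def L_simplex_splx L_simplex_act ord_hom_compose_assoc
          split: if_splits)
  next
    fix u v k x assume uv: "u \<le> v" and x: "x \<in> splx (ob (L_simplex t m) u) k"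
    then have tu: "t \<le> u" "x \<in> ord_hom k m"
      by (simp_all add: L_simplex_splx split: if_splits)
    then show "L_map t m \<theta> v k (tr (L_simplex t m) u v k x) =
        tr (L_simplex s n) u v k (L_map t m \<theta> u k x)"
      using uv st * order_trans[OF tu(1) uv] by (simp add: L_map_def L_simplex_splx L_simplex_tr)
  qed
qed

lemma vertex_fun_L_map: "\<theta> \<in> ord_hom m n \<Longrightarrow> vertex_fun t m (L_map t m \<theta>) = \<theta>"
  by (rule extensionalityI[of _ "{0..m}"])
    (simp_all add: vertex_fun_def L_map_def L_simplex_splx vertex_in compose_vertex
      ord_hom_extensional)

text \<open>The source has a vertex at stage \<open>t\<close>, so the target is nonempty
  there.\<close>

lemma sdiag_map_L_simplex_le:
  assumes "sdiag_map (L_simplex t m) (L_simplex s n) \<phi>"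
  shows "s \<le> t"
  using sdiag_mapD(2)[OF assms, of "vertex 0" t 0] vertex_in[of 0 m]
  by (simp add: L_simplex_splx split: if_splits)

text \<open>A simplex of \<open>\<Delta>\<^sup>n\<close> is determined by its vertices, hence so is a map into it.\<close>

lemma sdiag_map_L_simplex_eq:
  assumes \<phi>: "sdiag_map (L_simplex t m) (L_simplex s n) \<phi>"
  shows "\<phi> = L_map t m (vertex_fun t m \<phi>)" and "vertex_fun t m \<phi> \<in> ord_hom m n"
proof -
  note st = sdiag_map_L_simplex_le[OF \<phi>]
  have closed: "\<phi> u k x \<in> ord_hom k n" if "t \<le> u" "x \<in> ord_hom k m" for u k x
    using sdiag_mapD(2)[OF \<phi>, of x u k] that order_trans[OF st that(1)]
    by (simp add: L_simplex_splx)
  \<comment> \<open>The transition maps of both diagrams are identities where nonempty, so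
    naturality makes the component independent of the stage.\<close>
  have stage: "\<phi> u 0 (vertex i) = \<phi> t 0 (vertex i)" if "t \<le> u" "i \<le> m" for u i
    using sdiag_mapD(3)[OF \<phi>, of t u "vertex i" 0] that st closed[of t "vertex i" 0]
      vertex_in[OF that(2)]
    by (simp add: L_simplex_splx L_simplex_tr)
  \<comment> \<open>Acting by \<open>vertex p\<close> extracts the \<open>p\<close>-th vertex of a
    simplex; compatibility with this action reduces \<open>\<phi>\<close> to its values on
    0-simplices.\<close>
  have val: "\<phi> u k x p = \<phi> t 0 (vertex (x p)) 0"
    if u: "t \<le> u" and x: "x \<in> ord_hom k m" and p: "p \<le> k" for u k x p
  proof -
    have "\<phi> u 0 (compose {0..0} x (vertex p)) = compose {0..0} (\<phi> u k x) (vertex p)"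
      using sset_mapD(3)[OF sdiag_mapD(1)[OF \<phi>, of u] vertex_in[OF p], of x] u x
      by (simp add: L_simplex_act L_simplex_splx)
    then have "\<phi> u k x p = \<phi> u 0 (vertex (x p)) 0"
      using compose_vertex[OF x p] by (simp add: compose_def vertex_def)
    then show ?thesis
      using stage[OF u] ord_hom_le[OF x p] by simp
  qed
  have eq: "\<phi> u k x = compose {0..k} (vertex_fun t m \<phi>) x" if "t \<le> u" "x \<in> ord_hom k m" for u k x
    using val[OF that] ord_hom_extensional[OF closed[OF that]] ord_hom_le[OF that(2)]
    by (auto simp: compose_def vertex_fun_def extensional_def)
  have "\<phi> u k x = L_map t m (vertex_fun t m \<phi>) u k x" for u k x
  proof (cases "x \<in> splx (ob (L_simplex t m) u) k")
    case True
    then show ?thesis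
      using eq by (simp add: L_map_def L_simplex_splx split: if_splits)
  next
    case False
    \<comment> \<open>Off the simplices of the source both sides are
      \<open>undefined\<close>.\<close>
    then show ?thesis
      using PiE_arb[OF sset_mapD(1)[OF sdiag_mapD(1)[OF \<phi>]] False] by (simp add: L_map_def)
  qed
  then show "\<phi> = L_map t m (vertex_fun t m \<phi>)"
    by blast
  \<comment> \<open>The vertex function is the image of the top simplex of the source, hence an
    ordinal number map.\<close>
  have "compose {0..m} (vertex_fun t m \<phi>) (restrict id {0..m}) = vertex_fun t m \<phi>"
    by (auto simp: compose_def vertex_fun_def)
  then show "vertex_fun t m \<phi> \<in> ord_hom m n"
    using eq[OF order_refl ord_hom_id] closed[OF order_refl ord_hom_id] by simp
qed

section \<open>Restriction of simplices along ordinal number maps\<close>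

text \<open>Contravariant functoriality. By \<open>s \<le> t\<close>, the inner restriction is
  defined at every stage where the outer one has simplices.\<close>

lemma pull_pull:
  assumes "\<theta> \<in> ord_hom m n" "\<phi> \<in> ord_hom l m" "s \<le> t"
  shows "pull t l \<phi> (pull s m \<theta> f) = pull t l (compose {0..l} \<theta> \<phi>) f"
proof (intro ext)
  fix u k x
  show "pull t l \<phi> (pull s m \<theta> f) u k x = pull t l (compose {0..l} \<theta> \<phi>) f u k x"
  proof (cases "t \<le> u \<and> x \<in> ord_hom k l")
    case True
    moreover from this have "s \<le> u"
      using assms(3) by auto
    ultimately show ?thesis
      using ord_hom_compose[OF _ assms(2)]
      by (simp add: sdiag_comp_def compose_eq L_map_def L_simplex_splx
          ord_hom_compose_assoc[of x k l])
  next
    case False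
    then show ?thesis
      by (auto simp: sdiag_comp_def compose_def L_simplex_splx)
  qed
qed

lemma simplices_pull:
  assumes f: "(s, n, f) \<in> simplices X" and \<theta>: "\<theta> \<in> ord_hom m n" and st: "s \<le> t"
  shows "(t, m, pull t m \<theta> f) \<in> simplices X"
  using f sdiag_comp_map[OF L_simplex_sdiag L_map_sdiag_map[OF \<theta> st]]
  by (simp add: simplices_def)

text \<open>\<open>L_map t m \<theta>\<close> is a morphism over \<open>X\<close> from the
  restricted simplex to \<open>f\<close> with vertex function \<open>\<theta>\<close>, so the
  colimit identifies the two points.\<close>

lemma colim_in_pull:
  assumes f: "(s, n, f) \<in> simplices X" and \<theta>: "\<theta> \<in> ord_hom m n" and st: "s \<le> t" and i: "i \<le> m"
  shows "colim_in (U_diagram X) (t, m, pull t m \<theta> f) i = colim_in (U_diagram X) (s, n, f) (\<theta> i)"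
proof -
  have "L_map t m \<theta> \<in> arr (U_diagram X) (t, m, pull t m \<theta> f) (s, n, f)"
    using L_map_sdiag_map[OF \<theta> st] by (simp add: U_diagram_simps simplices_hom_def)
  from colim_in_mor[OF U_diagram_ep_diagram _ _ this, of i] show ?thesis
    using f simplices_pull[OF f \<theta> st] i
    by (simp add: U_diagram_simps vertex_fun_L_map[OF \<theta>] U_space_def)
qed

section \<open>Simplices of the skeleton\<close>

text \<open>Every value of \<open>f\<close> is obtained by acting on the image of the top simplex
  \<open>restrict id {0..n}\<close>, which has dimension \<open>n \<le> r\<close>.\<close>

lemma simplices_sk_diag:
  assumes X: "is_sdiag X" and n: "n \<le> r" and f: "(s, n, f) \<in> simplices X"
  shows "(s, n, f) \<in> simplices (sk_diag r X)"
proof -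
  have F: "sdiag_map (L_simplex s n) X f"
    using f by (simp add: simplices_def)
  have in_skel: "f u k x \<in> splx (skel r (ob X u)) k"
    if x: "x \<in> splx (ob (L_simplex s n) u) k" for u k x
  proof -
    have su: "s \<le> u" "x \<in> ord_hom k n"
      using x by (simp_all add: L_simplex_splx split: if_splits)
    have id: "restrict id {0..n} \<in> splx (ob (L_simplex s n) u) n"
      using su ord_hom_id by (simp add: L_simplex_splx)
    have "f u k x = act (ob X u) k n x (f u n (restrict id {0..n}))"
      using sset_mapD(3)[OF sdiag_mapD(1)[OF F] su(2) id]
      by (simp add: L_simplex_act ord_hom_id_compose[OF su(2)])
    then show ?thesis
      using n su(2) sdiag_mapD(2)[OF F id] by (auto simp: skel_def)
  qed
  have "sdiag_map (L_simplex s n) (sk_diag r X) f"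
    unfolding sdiag_map_def sset_map_def
  proof (intro conjI allI impI ballI)
    show "f u k \<in> splx (ob (L_simplex s n) u) k \<rightarrow>\<^sub>E splx (ob (sk_diag r X) u) k" for u k
      using sset_mapD(1)[OF sdiag_mapD(1)[OF F], of u k] in_skel
      by (simp add: sk_diag_def PiE_iff)
    show "f u k (act (ob (L_simplex s n) u) k l \<theta> x) = act (ob (sk_diag r X) u) k l \<theta> (f u l x)"
      if "\<theta> \<in> ord_hom k l" "x \<in> splx (ob (L_simplex s n) u) l" for u k l \<theta> x
      using sset_mapD(3)[OF sdiag_mapD(1)[OF F] that] by (simp add: sk_diag_def skel_def)
    show "f v k (tr (L_simplex s n) u v k x) = tr (sk_diag r X) u v k (f u k x)"
      if "u \<le> v" "x \<in> splx (ob (L_simplex s n) u) k" for u v k x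
      using sdiag_mapD(3)[OF F that] in_skel[OF that(2)] by (simp add: sk_diag_def)
  qed
  then show ?thesis
    by (simp add: simplices_def)
qed

text \<open>Both functions are \<open>undefined\<close> off the simplices of the source, so they
  agree on the nose. Hence a simplex of the skeleton and its image in \<open>X\<close> are the same
  triple.\<close>

lemma simplices_map_sdiag_incl:
  assumes f: "(s, n, f) \<in> simplices A"
  shows "simplices_map (sdiag_incl A) (s, n, f) = (s, n, f)"
proof -
  have F: "sdiag_map (L_simplex s n) A f"
    using f by (simp add: simplices_def)
  have "sdiag_comp (L_simplex s n) (sdiag_incl A) f u k x = f u k x" for u k x
    using sdiag_mapD(2)[OF F] PiE_arb[OF sset_mapD(1)[OF sdiag_mapD(1)[OF F]]]
    by (cases "x \<in> splx (ob (L_simplex s n) u) k")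
      (simp_all add: sdiag_comp_def compose_def sdiag_incl_def)
  then show ?thesis
    by (auto simp: simplices_map_def intro!: ext)
qed

lemma simplices_sk_diagD:
  assumes X: "is_sdiag X" and f: "(s, n, f) \<in> simplices (sk_diag r X)"
  shows "(s, n, f) \<in> simplices X"
proof -
  have "sdiag_map (L_simplex s n) (sk_diag r X) f"
    using f by (simp add: simplices_def)
  from sdiag_comp_map[OF L_simplex_sdiag this sk_diag_incl[OF X]] show ?thesis
    using simplices_map_sdiag_incl[OF f] by (simp add: simplices_def simplices_map_def)
qed

section \<open>The vertex cocone with values in the realization of the skeleton\<close>

definition vertex_cocone ::
  "nat \<Rightarrow> 'a sdiag \<Rightarrow> 'a simplex_over \<Rightarrow> nat \<Rightarrow> ('a simplex_over \<times> nat) set" where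
  "vertex_cocone r X = (\<lambda>(s, n, f). \<lambda>i\<in>{0..n}.
     colim_in (U_diagram (sk_diag r X)) (s, 0, pull s 0 (vertex i) f) 0)"

lemma simplices_vertex:
  assumes X: "is_sdiag X" and f: "(s, n, f) \<in> simplices X" and i: "i \<le> n"
  shows "(s, 0, pull s 0 (vertex i) f) \<in> simplices (sk_diag r X)"
  by (intro simplices_sk_diag[OF X] simplices_pull[OF f] vertex_in i) simp_all

lemma vertex_cocone_dist:
  assumes X: "is_sdiag X" and r: "1 \<le> r" and f: "(s, n, f) \<in> simplices X"
    and ij: "i < j" "j \<le> n"
  shows "dst (realization (sk_diag r X)) (vertex_cocone r X (s, n, f) i)
    (vertex_cocone r X (s, n, f) j) \<le> s"
proof -
  let ?U = "U_diagram (sk_diag r X)"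
  \<comment> \<open>The edge from \<open>i\<close> to \<open>j\<close>; it is monotone because
    \<open>i < j\<close>.\<close>
  define e where "e = (\<lambda>p\<in>{0..1::nat}. if p = 0 then i else j)"
  have e: "e \<in> ord_hom 1 n"
    using ij by (auto simp: e_def ord_hom_def mono_on_def)
  have edge: "(s, 1, pull s 1 e f) \<in> simplices (sk_diag r X)"
    by (intro simplices_sk_diag[OF X r] simplices_pull[OF f e]) simp
  have ends: "vertex_cocone r X (s, n, f) (e p) = colim_in ?U (s, 1, pull s 1 e f) p"
    if p: "p \<le> 1" for p
  proof -
    have "pull s 0 (vertex p) (pull s 1 e f) = pull s 0 (vertex (e p)) f"
      using pull_pull[OF e vertex_in[OF p] order_refl, of s f] compose_vertex[OF e p] by simp
    then show ?thesis
      using colim_in_pull[OF edge vertex_in[OF p] order_refl, of 0] ord_hom_le[OF e p]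
      by (simp add: vertex_cocone_def)
  qed
  \<comment> \<open>The canonical map at the edge does not increase distance, and the two points of
    \<open>U_space s 1\<close> are at distance \<open>s\<close>.\<close>
  have "ep_map (U_space s 1) (realization (sk_diag r X)) (colim_in ?U (s, 1, pull s 1 e f))"
    using ep_colim_cocone[OF U_diagram_ep_diagram, of "sk_diag r X"] edge
    by (auto simp: ep_cocone_def realization_def U_diagram_simps)
  then have "dst (realization (sk_diag r X)) (colim_in ?U (s, 1, pull s 1 e f) 0)
      (colim_in ?U (s, 1, pull s 1 e f) 1) \<le> dst (U_space s 1) 0 1"
    unfolding ep_map_def
    by (elim conjE ballE[of _ _ 0] ballE[of _ _ 1]) (simp_all add: U_space_def)
  also have "\<dots> = s"
    by (simp add: U_space_def)
  finally have "dst (realization (sk_diag r X)) (colim_in ?U (s, 1, pull s 1 e f) 0)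
      (colim_in ?U (s, 1, pull s 1 e f) 1) \<le> s" .
  then show ?thesis
    using ends[of 0] ends[of 1] by (simp add: e_def)
qed

lemma vertex_cocone_ep_cocone:
  assumes X: "is_sdiag X" and r: "1 \<le> r"
  shows "ep_cocone (U_diagram X) (realization (sk_diag r X)) (vertex_cocone r X)"
  unfolding ep_cocone_def U_diagram_simps(1,2)
proof (intro conjI ballI)
  let ?R = "realization (sk_diag r X)"
  have R: "ep_metric ?R"
    unfolding realization_def by (rule ep_colim_metric)
  fix j assume "j \<in> simplices X"
  moreover obtain s n f where j: "j = (s, n, f)"
    by (metis prod_cases3)
  ultimately have f: "(s, n, f) \<in> simplices X"
    by simp
  have pts: "vertex_cocone r X j i \<in> pts ?R" if "i \<le> n" for i
    using that simplices_vertex[OF X f that]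
    by (auto simp: j vertex_cocone_def realization_def ep_colim_def U_diagram_simps U_space_def
        intro!: colim_in_in)
  have dist: "dst ?R (vertex_cocone r X j p) (vertex_cocone r X j q) \<le> (if p = q then 0 else s)"
    if "p \<le> n" "q \<le> n" for p q
  proof (cases p q rule: linorder_cases)
    case less
    then show ?thesis
      using vertex_cocone_dist[OF X r f less that(2)] by (simp add: j)
  next
    case equal
    then show ?thesis
      using R pts[OF that(1)] by (simp add: ep_metric_def)
  next
    \<comment> \<open>The edge bound is for increasing pairs; symmetry of the distance gives the
      rest.\<close>
    case greater
    then show ?thesis
      using vertex_cocone_dist[OF X r f greater that(1)] R pts that by (simp add: j ep_metric_def)
  qed
  have "vertex_cocone r X j \<in> extensional {0..n}"
    by (simp add: j vertex_cocone_def)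
  then show "ep_map (spc (U_diagram X) j) ?R (vertex_cocone r X j)"
    using pts dist by (auto simp: ep_map_def j U_diagram_simps U_space_def PiE_iff)
next
  fix i j h x
  assume "i \<in> simplices X" "j \<in> simplices X" "h \<in> simplices_hom i j"
    "x \<in> pts (spc (U_diagram X) i)"
  moreover obtain t m f s n g where ij: "i = (t, m, f)" "j = (s, n, g)"
    by (metis prod_cases3)
  ultimately have g: "(s, n, g) \<in> simplices X"
    and h: "sdiag_map (L_simplex t m) (L_simplex s n) h" "f = sdiag_comp (L_simplex t m) g h"
    and x: "x \<le> m"
    by (auto simp: simplices_hom_def U_diagram_simps U_space_def)
  define \<theta> where "\<theta> = vertex_fun t m h"
  have \<theta>: "\<theta> \<in> ord_hom m n" and f: "f = pull t m \<theta> g"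
    using sdiag_map_L_simplex_eq[OF h(1)] h(2) by (simp_all add: \<theta>_def)
  have st: "s \<le> t"
    by (rule sdiag_map_L_simplex_le[OF h(1)])
  have \<theta>x: "\<theta> x \<le> n"
    by (rule ord_hom_le[OF \<theta> x])
  have "pull t 0 (vertex x) f = pull t 0 (vertex (\<theta> x)) g"
    by (simp add: f pull_pull[OF \<theta> vertex_in[OF x] order_refl] compose_vertex[OF \<theta> x])
  \<comment> \<open>\<open>vertex 0\<close> is the identity of [0], so this restriction only raises
    the stage from \<open>s\<close> to \<open>t\<close>. The 0-simplices representing the two sides
    thus differ in stage alone, and \<open>colim_in_pull\<close> identifies their classes.\<close>
  moreover have "pull t 0 (vertex 0) (pull s 0 (vertex (\<theta> x)) g) = pull t 0 (vertex (\<theta> x)) g"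
    using compose_vertex[OF vertex_in[OF \<theta>x] order_refl]
      pull_pull[OF vertex_in[OF \<theta>x] vertex_in[OF order_refl] st, of g] by simp
  ultimately show "vertex_cocone r X j (mor (U_diagram X) i j h x) = vertex_cocone r X i x"
    using colim_in_pull[OF simplices_vertex[OF X g \<theta>x] vertex_in[of 0 0] st, of 0 r] x \<theta>x
    by (simp add: ij U_diagram_simps vertex_cocone_def \<theta>_def[symmetric])
qed

section \<open>The isomorphism of realizations\<close>

lemma realization_sk_diag_iso:
  assumes X: "is_sdiag X" and r: "1 \<le> r"
  shows "ep_iso (realization (sk_diag r X)) (realization X)
    (realization_map (sk_diag r X) X (sdiag_incl (sk_diag r X)))"
    (is "ep_iso ?R ?S ?f")
proof -
  let ?U = "U_diagram X" and ?V = "U_diagram (sk_diag r X)"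
  let ?g = "colim_desc ?U (vertex_cocone r X)"
  note c = vertex_cocone_ep_cocone[OF X r]
  have R: "ep_metric ?R" and S: "ep_metric ?S"
    unfolding realization_def by (rule ep_colim_metric)+
  have g_map: "ep_map ?S ?R ?g"
    unfolding realization_def[of X] by (rule colim_desc_map[OF R c U_diagram_ep_diagram])
  have f_in: "?f (colim_in ?V (s, n, f) i) = colim_in ?U (s, n, f) i"
    if "(s, n, f) \<in> simplices (sk_diag r X)" "i \<le> n" for s n f i
    using realization_map_ep_map(2)[OF sk_diag_incl[OF X] that(1), of i] that(2)
    by (simp add: simplices_map_sdiag_incl[OF that(1)] U_diagram_simps U_space_def)
  have g_in: "?g (colim_in ?U (s, n, f) i) = colim_in ?V (s, 0, pull s 0 (vertex i) f) 0"
    if "(s, n, f) \<in> simplices X" "i \<le> n" for s n f i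
    using colim_desc_in[OF c U_diagram_ep_diagram, of "(s, n, f)" i] that
    by (simp add: U_diagram_simps U_space_def vertex_cocone_def)
  \<comment> \<open>Stated for any \<open>Y\<close>: the skeleton is the case needed for
    \<open>gf\<close>, and \<open>X\<close> the case needed for \<open>fg\<close>.\<close>
  have vertex_in_colim: "colim_in (U_diagram Y) (s, 0, pull s 0 (vertex i) f) 0 =
      colim_in (U_diagram Y) (s, n, f) i"
    if "(s, n, f) \<in> simplices Y" "i \<le> n" for Y :: "'a sdiag" and s n f i
    using colim_in_pull[OF that(1) vertex_in[OF that(2)] order_refl, of 0] by simp
  have gf: "?g (?f A) = A" if "A \<in> pts ?R" for A
  proof -
    from that have "A \<in> colim_pts ?V"
      by (simp add: realization_def ep_colim_def)
    then obtain s n f i where "(s, n, f) \<in> simplices (sk_diag r X)" "i \<le> n"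
      "A = colim_in ?V (s, n, f) i"
      by (elim colim_pts_cases) (auto simp: U_diagram_simps U_space_def)
    then show ?thesis
      by (simp add: f_in g_in simplices_sk_diagD[OF X] vertex_in_colim)
  qed
  have fg: "?f (?g A) = A" if "A \<in> pts ?S" for A
  proof -
    from that have "A \<in> colim_pts ?U"
      by (simp add: realization_def ep_colim_def)
    then obtain s n f i where "(s, n, f) \<in> simplices X" "i \<le> n" "A = colim_in ?U (s, n, f) i"
      by (elim colim_pts_cases) (auto simp: U_diagram_simps U_space_def)
    then show ?thesis
      by (simp add: f_in g_in simplices_vertex[OF X] vertex_in_colim)
  qed
  show ?thesis
    unfolding ep_iso_def
    using R S realization_map_ep_map(1)[OF sk_diag_incl[OF X]] g_map gf fg by blast
qed

theorem lemma11:
  fixes X :: "'a sdiag"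
  assumes "is_sdiag X"
  shows "ep_iso (realization (sk_diag 1 X)) (realization X)
           (realization_map (sk_diag 1 X) X (sdiag_incl (sk_diag 1 X)))"
  by (rule realization_sk_diag_iso[OF assms order_refl])

end
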